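(* Let $R$ be a (commutative) Noetherian domain, $a$ an ideal of $R$, and $A$ any $R$-module. Then ${}_eH^n_a(A)=(R^n\Gamma_a)(A)=0$ for all negative integers $n$.
   Context: All modules are unitary. A submodule $N$ of $M$ is essential, $N\leqslant_e M$, if it meets every nonzero submodule of $M$ nontrivially. A sequence $\cdots\to N_{i-1}\stackrel{f_{i-1}}{\to}N_i\stackrel{f_i}{\to}N_{i+1}\to\cdots$ of $R$-modules is e-exact if $\operatorname{Im}(f_{i-1})\leqslant_e\operatorname{Ker}(f_i)$ at every term. An $R$-module $E$ is e-injective if for every monomorphism $f_1:A_1\to A_2$ and every homomorphism $f_2:A_1\to E$ there exist $0\neq r\in R$ and $f_3:A_2\to E$ with $f_3f_1=rf_2$. An e-injective resolution of $A$ is an e-exact sequence $0\to A\to E^0\stackrel{d^0}{\to}E^1\stackrel{d^1}{\to}\cdots$ with each $E^i$ e-injective; its deleted resolution is $E^A:0\to E^0\stackrel{d^0}{\to}E^1\to\cdots$ (with zero terms in negative degrees). $\Gamma_a(M)=\{m\in M:a^km=0\text{ for some }k\in\mathbb{N}\}$ is the $a$-torsion functor. The $n$-th e-cohomology module of $A$ with respect to $a$ is ${}_eH^n_a(A)=(R^n\Gamma_a)(A)=H^n(\Gamma_a(E^A))=\operatorname{Ker}(\Gamma_a(d^n))/\operatorname{Im}(\Gamma_a(d^{n-1}))$, where $E^A$ is the deleted complex of an e-injective resolution of $A$. *)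

theory Defs
  imports "HOL-Algebra.Ring_Divisibility" "HOL-Algebra.Module" "HOL-Algebra.Ideal_Product"
begin

definition module_hom ::
    "('r, 'q) ring_scheme \<Rightarrow> ('r, 'm, 'x) module_scheme \<Rightarrow> ('r, 'n, 'y) module_scheme \<Rightarrow> ('m \<Rightarrow> 'n) set"
  where "module_hom R M N =
    {f \<in> hom (add_monoid M) (add_monoid N).
       \<forall>r\<in>carrier R. \<forall>x\<in>carrier M. f (r \<odot>\<^bsub>M\<^esub> x) = r \<odot>\<^bsub>N\<^esub> f x}"

text \<open>The ring multiplication and unit fields of a module record carry no meaning for a module;
  they are filled arbitrarily below.\<close>

definition quotient_module ::
    "('r, 'q) ring_scheme \<Rightarrow> ('r, 'm, 'x) module_scheme \<Rightarrow> 'm set \<Rightarrow> ('r, 'm set) module"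
  where "quotient_module R M N =
    \<lparr>carrier = a_rcosets\<^bsub>M\<^esub> N, monoid.mult = (\<lambda>S T. N), one = N, zero = N, add = set_add M,
     smult = (\<lambda>r S. N <+>\<^bsub>M\<^esub> ((\<lambda>x. r \<odot>\<^bsub>M\<^esub> x) ` S))\<rparr>"

definition zero_submodule :: "('r, 'm) module \<Rightarrow> ('r, 'm) module"
  where "zero_submodule M = M\<lparr>carrier := {\<zero>\<^bsub>M\<^esub>}\<rparr>"

definition is_zero_module :: "('r, 'm, 'x) module_scheme \<Rightarrow> bool"
  where "is_zero_module M \<longleftrightarrow> carrier M = {\<zero>\<^bsub>M\<^esub>}"

definition essential_submodule ::
    "'m set \<Rightarrow> ('r, 'q) ring_scheme \<Rightarrow> ('r, 'm, 'x) module_scheme \<Rightarrow> bool"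
  where "essential_submodule N R M \<longleftrightarrow>
    submodule N R M \<and> (\<forall>L. submodule L R M \<and> L \<noteq> {\<zero>\<^bsub>M\<^esub>} \<longrightarrow> N \<inter> L \<noteq> {\<zero>\<^bsub>M\<^esub>})"

definition e_exact_at ::
    "('r, 'q) ring_scheme \<Rightarrow> ('r, 'l) module \<Rightarrow> ('l \<Rightarrow> 'm) \<Rightarrow> ('r, 'm) module \<Rightarrow>
     ('m \<Rightarrow> 'n) \<Rightarrow> ('r, 'n) module \<Rightarrow> bool"
  where "e_exact_at R L f M g N \<longleftrightarrow>
    essential_submodule (f ` carrier L) R (M\<lparr>carrier := a_kernel M N g\<rparr>)"

text \<open>The test modules range over all modules whose carrier lies in the type
  \<open>('r \<times> 'e) rel\<close>. This type is large enough: lemma \<open>e_injective_all_types\<close>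
  at the end of this theory shows that an e-injective module in this sense has the extension property
  for test modules over arbitrary types, so nothing is lost by fixing it.\<close>

definition e_injective :: "('r, 'q) ring_scheme \<Rightarrow> ('r, 'e) module \<Rightarrow> bool"
  where "e_injective R E \<longleftrightarrow> module R E \<and>
    (\<forall>(A1 :: ('r, ('r \<times> 'e) rel) module) (A2 :: ('r, ('r \<times> 'e) rel) module) f1 f2.
       module R A1 \<and> module R A2 \<and>
       f1 \<in> module_hom R A1 A2 \<and> inj_on f1 (carrier A1) \<and> f2 \<in> module_hom R A1 E \<longrightarrow>
       (\<exists>r\<in>carrier R - {\<zero>\<^bsub>R\<^esub>}. \<exists>f3\<in>module_hom R A2 E.
          \<forall>x\<in>carrier A1. f3 (f1 x) = r \<odot>\<^bsub>E\<^esub> f2 x))"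

definition e_injective_resolution ::
    "('r, 'q) ring_scheme \<Rightarrow> ('r, 'm) module \<Rightarrow> ('m \<Rightarrow> 'e) \<Rightarrow> (nat \<Rightarrow> ('r, 'e) module) \<Rightarrow>
     (nat \<Rightarrow> 'e \<Rightarrow> 'e) \<Rightarrow> bool"
  where "e_injective_resolution R A \<epsilon> E d \<longleftrightarrow>
    module R A \<and> (\<forall>i. e_injective R (E i)) \<and>
    \<epsilon> \<in> module_hom R A (E 0) \<and> (\<forall>i. d i \<in> module_hom R (E i) (E (Suc i))) \<and>
    e_exact_at R (zero_submodule A) (\<lambda>_. \<zero>\<^bsub>A\<^esub>) A \<epsilon> (E 0) \<and>
    e_exact_at R A \<epsilon> (E 0) (d 0) (E 1) \<and>
    (\<forall>i. e_exact_at R (E i) (d i) (E (Suc i)) (d (Suc i)) (E (Suc (Suc i))))"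

text \<open>The deleted resolution as a complex indexed by the integers; the zero module placed in
  negative degrees is realised on the zero element of \<open>E 0\<close>.\<close>

definition deleted_obj :: "(nat \<Rightarrow> ('r, 'e) module) \<Rightarrow> int \<Rightarrow> ('r, 'e) module"
  where "deleted_obj E n = (if n \<ge> 0 then E (nat n) else zero_submodule (E 0))"

definition deleted_map :: "(nat \<Rightarrow> ('r, 'e) module) \<Rightarrow> (nat \<Rightarrow> 'e \<Rightarrow> 'e) \<Rightarrow> int \<Rightarrow> 'e \<Rightarrow> 'e"
  where "deleted_map E d n = (if n \<ge> 0 then d (nat n) else (\<lambda>_. \<zero>\<^bsub>E 0\<^esub>))"

definition cohomology_module ::
    "('r, 'q) ring_scheme \<Rightarrow> (int \<Rightarrow> ('r, 'm) module) \<Rightarrow> (int \<Rightarrow> 'm \<Rightarrow> 'm) \<Rightarrow> int \<Rightarrow> ('r, 'm set) module"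
  where "cohomology_module R C \<delta> n =
    quotient_module R ((C n)\<lparr>carrier := a_kernel (C n) (C (n + 1)) (\<delta> n)\<rparr>)
      (\<delta> (n - 1) ` carrier (C (n - 1)))"

text \<open>The \<open>n\<close>-th right derived functor, computed on a resolution \<open>E\<close>, \<open>d\<close>, of the functor
  with object part \<open>Fobj\<close> and morphism part \<open>Fmor M N f\<close> for \<open>f : M \<rightarrow> N\<close>.\<close>

definition right_derived ::
    "('r, 'q) ring_scheme \<Rightarrow> (('r, 'e) module \<Rightarrow> ('r, 'f) module) \<Rightarrow>
     (('r, 'e) module \<Rightarrow> ('r, 'e) module \<Rightarrow> ('e \<Rightarrow> 'e) \<Rightarrow> 'f \<Rightarrow> 'f) \<Rightarrow>
     (nat \<Rightarrow> ('r, 'e) module) \<Rightarrow> (nat \<Rightarrow> 'e \<Rightarrow> 'e) \<Rightarrow> int \<Rightarrow> ('r, 'f set) module"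
  where "right_derived R Fobj Fmor E d n =
    cohomology_module R (\<lambda>i. Fobj (deleted_obj E i))
      (\<lambda>i. Fmor (deleted_obj E i) (deleted_obj E (i + 1)) (deleted_map E d i)) n"

text \<open>The power \<open>a\<^sup>k\<close> is taken in the multiplicative monoid of ideals of \<open>R\<close>, with \<open>a\<^sup>0 = R\<close>.\<close>

definition torsion_module ::
    "('r, 'q) ring_scheme \<Rightarrow> 'r set \<Rightarrow> ('r, 'm) module \<Rightarrow> ('r, 'm) module"
  where "torsion_module R a M = M\<lparr>carrier :=
    {m \<in> carrier M. \<exists>k::nat. \<forall>x \<in> a [^]\<^bsub>ideals_set R\<^esub> k. x \<odot>\<^bsub>M\<^esub> m = \<zero>\<^bsub>M\<^esub>}\<rparr>"

definition torsion_map ::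
    "('r, 'q) ring_scheme \<Rightarrow> 'r set \<Rightarrow> ('r, 'm) module \<Rightarrow> ('r, 'n) module \<Rightarrow> ('m \<Rightarrow> 'n) \<Rightarrow> 'm \<Rightarrow> 'n"
  where "torsion_map R a M N f = restrict f (carrier (torsion_module R a M))"

definition e_cohomology ::
    "('r, 'q) ring_scheme \<Rightarrow> 'r set \<Rightarrow> (nat \<Rightarrow> ('r, 'e) module) \<Rightarrow> (nat \<Rightarrow> 'e \<Rightarrow> 'e) \<Rightarrow> int \<Rightarrow>
     ('r, 'e set) module"
  where "e_cohomology R a E d n =
    (let G = (\<lambda>i. torsion_module R a (deleted_obj E i));
         \<gamma> = (\<lambda>i. torsion_map R a (deleted_obj E i) (deleted_obj E (i + 1)) (deleted_map E d i))
     in quotient_module R ((G n)\<lparr>carrier := a_kernel (G n) (G (n + 1)) (\<gamma> n)\<rparr>)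
          (\<gamma> (n - 1) ` carrier (G (n - 1))))"

text \<open>The rest of the theory proves that the type of the test modules in \<open>e_injective\<close> is
  immaterial. Given \<open>f1 : A1 \<rightarrow> A2\<close> and \<open>f2 : A1 \<rightarrow> E\<close> over any types, pass to a quotient of
  \<open>E \<oplus> A2\<close> by a submodule containing the image of \<open>(f2, - f1)\<close> and maximal subject to
  meeting \<open>E\<close> trivially. Any two distinct elements \<open>p\<close>, \<open>q\<close> of this essential extension of \<open>E\<close>
  have some \<open>r\<close> with \<open>0 \<noteq> r (p - q) \<in> E\<close>; colouring the pair by \<open>(r, r (p - q))\<close> leaves no
  monochromatic triangle, and an Erdos-Rado argument then embeds the quotient into
  \<open>('r \<times> 'e) rel\<close>.\<close>

lemma triangle_free_inj:
  fixes P :: "'p set" and c :: "'p \<Rightarrow> 'p \<Rightarrow> 'k"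
  assumes tri: "\<And>x y z. x \<in> P \<Longrightarrow> y \<in> P \<Longrightarrow> z \<in> P \<Longrightarrow> x \<noteq> y \<Longrightarrow> y \<noteq> z \<Longrightarrow> x \<noteq> z \<Longrightarrow>
    c x y = c y z \<Longrightarrow> c x z = c y z \<Longrightarrow> False"
  shows "\<exists>\<phi> :: 'p \<Rightarrow> 'k rel. inj_on \<phi> P"
proof -
  obtain r :: "'p rel" where r: "Well_order r" "Field r = UNIV"
    using well_ordering[where 'a='p] by (elim exE conjE)
  define s where "s = r - Id"
  have wf: "wf s" using r unfolding s_def well_order_on_def by simp
  have lin: "linear_order_on UNIV r" using r unfolding well_order_on_def by simp
  have total: "x = y \<or> (x, y) \<in> s \<or> (y, x) \<in> s" for x y
    using lin unfolding s_def linear_order_on_def total_on_def by blast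
  have trans: "trans s"
    using lin unfolding s_def linear_order_on_def partial_order_on_def preorder_on_def
    by (metis trans_diff_Id)
  have tr: "(x, y) \<in> s \<Longrightarrow> (y, z) \<in> s \<Longrightarrow> (x, z) \<in> s" for x y z
    using trans by (meson transD)
  have irr: "(x, x) \<notin> s" for x unfolding s_def by simp
  define T where "T = wfrec s (\<lambda>T x v. x \<in> P \<and> (x, v) \<in> s \<and>
    (\<forall>y. (y, x) \<in> s \<longrightarrow> T y x \<longrightarrow> c y x = c y v))"
  have T: "T x v \<longleftrightarrow> x \<in> P \<and> (x, v) \<in> s \<and> (\<forall>y. (y, x) \<in> s \<longrightarrow> T y x \<longrightarrow> c y x = c y v)" for x v
    unfolding T_def by (subst wfrec[OF wf]) (simp add: cut_def)
  have Ts: "T x v \<Longrightarrow> (x, v) \<in> s" and TP: "T x v \<Longrightarrow> x \<in> P" for x v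
    using T[of x v] by blast+
  have Tc: "T y x \<Longrightarrow> T x v \<Longrightarrow> c y x = c y v" for x y v
    using T[of x v] Ts[of y x] by blast
  have Tt: "T y x \<Longrightarrow> T x v \<Longrightarrow> T y v" for x y v
  proof (induction y arbitrary: x v rule: wf_induct_rule[OF wf])
    case (1 y)
    show ?case
      unfolding T[of y v]
    proof (intro conjI allI impI)
      fix z assume z: "(z, y) \<in> s" "T z y"
      have "T z x" by (rule 1(1)[OF z 1(2)])
      hence "c z x = c z v" by (rule Tc[OF _ 1(3)])
      moreover have "c z y = c z x" by (rule Tc[OF z(2) 1(2)])
      ultimately show "c z y = c z v" by simp
    qed (auto intro: TP[OF 1(2)] tr[OF Ts[OF 1(2)] Ts[OF 1(3)]])
  qed
  have Tl: "T x v \<Longrightarrow> T x' v \<Longrightarrow> (x, x') \<in> s \<Longrightarrow> T x x'" for x x' v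
  proof (induction x rule: wf_induct_rule[OF wf])
    case (1 x)
    show ?case
      unfolding T[of x x']
    proof (intro conjI allI impI)
      fix y assume y: "(y, x) \<in> s" "T y x"
      have yv: "T y v" by (rule Tt[OF y(2) 1(2)])
      have "T y x'" by (rule 1(1)[OF y(1) yv 1(3) tr[OF y(1) 1(4)]])
      hence "c y x' = c y v" by (rule Tc[OF _ 1(3)])
      moreover have "c y x = c y v" by (rule Tc[OF y(2) 1(2)])
      ultimately show "c y x = c y x'" by simp
    qed (auto intro: TP[OF 1(2)] 1(4))
  qed
  have Ti': "c x v \<noteq> c x' v" if "T x v" "T x' v" "v \<in> P" "(x, x') \<in> s" for x x' v
  proof
    assume e: "c x v = c x' v"
    have "T x x'" by (rule Tl[OF that(1,2,4)])
    have "c x x' = c x v" by (rule Tc[OF \<open>T x x'\<close> that(2)])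
    moreover have "x \<noteq> x'" "x' \<noteq> v" "x \<noteq> v"
      using that(4) Ts[OF that(1)] Ts[OF that(2)] irr by auto
    ultimately show False
      using tri[OF TP[OF that(1)] TP[OF that(2)] that(3)] e by simp
  qed
  have Ti: "x = x'" if "T x v" "T x' v" "v \<in> P" "c x v = c x' v" for x x' v
    using Ti'[OF that(1,2,3)] Ti'[OF that(2,1,3)] that(4) total[of x x'] by metis
  define \<phi> where "\<phi> v = {(c x v, c y v) | x y. T x v \<and> T y v \<and> (x = y \<or> (x, y) \<in> s)}" for v
  have step: "T x w \<and> c x v = c x w"
    if eq: "\<phi> v = \<phi> w" and vP: "v \<in> P" and wP: "w \<in> P" and x: "T x v"
      and IH: "\<And>y. (y, x) \<in> s \<Longrightarrow> T y v \<or> T y w \<Longrightarrow> T y v \<and> T y w \<and> c y v = c y w" for v w x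
  proof -
    have "(c x v, c x v) \<in> \<phi> w" using eq x unfolding \<phi>_def by blast
    then obtain x' where x': "T x' w" "c x' w = c x v" unfolding \<phi>_def by auto
    have A: "T y w \<and> (y, x') \<in> s" if y: "T y v" "(y, x) \<in> s" for y
    proof -
      have yw: "T y w" "c y v = c y w" using IH y by auto
      have "(c y v, c x v) \<in> \<phi> w" using eq x y unfolding \<phi>_def by blast
      then obtain u t where ut: "c u w = c y v" "c t w = c x v" "T u w" "T t w" "u = t \<or> (u, t) \<in> s"
        unfolding \<phi>_def by auto
      have "u = y" "t = x'" using Ti wP ut yw x' by metis+
      moreover have "y \<noteq> x'" using yw x' Ti' x y vP by metis
      ultimately show ?thesis using ut yw by blast
    qed
    have B: "T y v \<and> (y, x) \<in> s" if y: "T y w" "(y, x') \<in> s" for y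
    proof -
      have "(c y w, c x' w) \<in> \<phi> v" using eq x' y unfolding \<phi>_def by blast
      then obtain u t where ut: "c u v = c y w" "c t v = c x' w" "T u v" "T t v" "u = t \<or> (u, t) \<in> s"
        unfolding \<phi>_def by auto
      have "t = x" using Ti vP ut x x' by metis
      moreover have "u \<noteq> t" using ut Ti' wP x' y by metis
      ultimately have ux: "(u, x) \<in> s" using ut by blast
      hence "T u w" "c u v = c u w" using IH ut by auto
      hence "u = y" using Ti wP ut y by metis
      thus ?thesis using ut ux by blast
    qed
    have "\<not> (x, x') \<in> s"
    proof
      assume l: "(x, x') \<in> s"
      have "T x x'" unfolding T[of x x']
        proof (intro conjI allI impI)
        fix y assume y: "(y, x) \<in> s" "T y x"
        have yv: "T y v" using Tt y x by blast
        have "T y x'" using Tl A yv y x' by blast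
        hence "c y x' = c y w" using Tc x' by blast
        moreover have "c y w = c y v" using IH y yv by metis
        moreover have "c y x = c y v" using Tc y x by blast
        ultimately show "c y x = c y x'" by simp
      qed (use TP x l in auto)
      hence "T x w" using Tt x' by blast
      hence "(x, x) \<in> s" using B l by blast
      thus False using irr by blast
    qed
    moreover have "\<not> (x', x) \<in> s"
    proof
      assume l: "(x', x) \<in> s"
      have "T x' x" unfolding T[of x' x]
        proof (intro conjI allI impI)
        fix y assume y: "(y, x') \<in> s" "T y x'"
        have yw: "T y w" using Tt y x' by blast
        have yv: "T y v" "(y, x) \<in> s" using B yw y by blast+
        have "T y x" using Tl x yv by blast
        hence "c y x = c y v" using Tc x by blast
        moreover have "c y w = c y v" using IH yv by metis
        moreover have "c y x' = c y w" using Tc y x' by blast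
        ultimately show "c y x' = c y x" by simp
      qed (use TP x' l in auto)
      hence "T x' v" using Tt x by blast
      hence "(x', x') \<in> s" using A l by blast
      thus False using irr by blast
    qed
    ultimately have "x = x'" using total by blast
    thus ?thesis using x' by simp
  qed
  have "v = w" if eq: "\<phi> v = \<phi> w" and vP: "v \<in> P" and wP: "w \<in> P" for v w
  proof -
    have Q: "T x v \<or> T x w \<Longrightarrow> T x v \<and> T x w \<and> c x v = c x w" for x
    proof (induction x rule: wf_induct_rule[OF wf])
      case (1 x)
      show ?case using 1(2)
      proof
        assume "T x v" thus ?thesis using step[of v w x] 1 eq vP wP by blast
      next
        assume "T x w" thus ?thesis using step[of w v x] 1 eq vP wP by metis
      qed
    qed
    have "(v, w) \<notin> s"
    proof
      assume "(v, w) \<in> s"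
      hence "T v w" unfolding T[of v w] using Q vP by blast
      thus False using Q Ts irr by blast
    qed
    moreover have "(w, v) \<notin> s"
    proof
      assume "(w, v) \<in> s"
      hence "T w v" unfolding T[of w v] using Q wP by metis
      thus False using Q Ts irr by blast
    qed
    ultimately show ?thesis using total by blast
  qed
  thus ?thesis by (meson inj_onI)
qed

lemma image_module:
  fixes \<pi> :: "'s \<Rightarrow> 'u" and S :: "('r, 's, 'x) module_scheme"
  assumes S: "module R S"
    and add: "\<And>x y x' y'. x \<in> carrier S \<Longrightarrow> y \<in> carrier S \<Longrightarrow> x' \<in> carrier S \<Longrightarrow> y' \<in> carrier S \<Longrightarrow>
      \<pi> x = \<pi> x' \<Longrightarrow> \<pi> y = \<pi> y' \<Longrightarrow> \<pi> (x \<oplus>\<^bsub>S\<^esub> y) = \<pi> (x' \<oplus>\<^bsub>S\<^esub> y')"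
    and smult: "\<And>r x x'. r \<in> carrier R \<Longrightarrow> x \<in> carrier S \<Longrightarrow> x' \<in> carrier S \<Longrightarrow>
      \<pi> x = \<pi> x' \<Longrightarrow> \<pi> (r \<odot>\<^bsub>S\<^esub> x) = \<pi> (r \<odot>\<^bsub>S\<^esub> x')"
  obtains M :: "('r, 'u) module"
  where "module R M" "carrier M = \<pi> ` carrier S" "\<pi> \<in> module_hom R S M"
proof -
  interpret S: module R S by (rule S)
  define \<sigma> where "\<sigma> = inv_into (carrier S) \<pi>"
  have \<sigma>: "\<pi> (\<sigma> (\<pi> x)) = \<pi> x" "\<sigma> (\<pi> x) \<in> carrier S" if "x \<in> carrier S" for x
    using that unfolding \<sigma>_def by (simp_all add: f_inv_into_f inv_into_into)
  define M :: "('r, 'u) module" where "M = \<lparr>carrier = \<pi> ` carrier S, monoid.mult = (\<lambda>u v. u),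
    one = \<pi> \<zero>\<^bsub>S\<^esub>, zero = \<pi> \<zero>\<^bsub>S\<^esub>, add = (\<lambda>u v. \<pi> (\<sigma> u \<oplus>\<^bsub>S\<^esub> \<sigma> v)),
    smult = (\<lambda>r u. \<pi> (r \<odot>\<^bsub>S\<^esub> \<sigma> u))\<rparr>"
  have c: "carrier M = \<pi> ` carrier S" and z: "\<zero>\<^bsub>M\<^esub> = \<pi> \<zero>\<^bsub>S\<^esub>" unfolding M_def by simp_all
  have a: "\<pi> x \<oplus>\<^bsub>M\<^esub> \<pi> y = \<pi> (x \<oplus>\<^bsub>S\<^esub> y)" if "x \<in> carrier S" "y \<in> carrier S" for x y
    unfolding M_def using add[OF \<sigma>(2) \<sigma>(2) that \<sigma>(1) \<sigma>(1)] that by simp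
  have s: "r \<odot>\<^bsub>M\<^esub> \<pi> x = \<pi> (r \<odot>\<^bsub>S\<^esub> x)" if "r \<in> carrier R" "x \<in> carrier S" for r x
    unfolding M_def using smult[OF that(1) \<sigma>(2) that(2) \<sigma>(1)] that by simp
  have "abelian_group M"
  proof (rule abelian_groupI)
    fix u v assume u: "u \<in> carrier M" and v: "v \<in> carrier M"
    obtain x y where xy: "x \<in> carrier S" "u = \<pi> x" "y \<in> carrier S" "v = \<pi> y" using u v c by blast
    show "u \<oplus>\<^bsub>M\<^esub> v \<in> carrier M" using xy a c by simp
    show "u \<oplus>\<^bsub>M\<^esub> v = v \<oplus>\<^bsub>M\<^esub> u" using xy a S.a_comm[of x y] by simp
    fix w assume "w \<in> carrier M"
    then obtain t where t: "t \<in> carrier S" "w = \<pi> t" using c by blast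
    show "(u \<oplus>\<^bsub>M\<^esub> v) \<oplus>\<^bsub>M\<^esub> w = u \<oplus>\<^bsub>M\<^esub> (v \<oplus>\<^bsub>M\<^esub> w)" using xy t a by (simp add: S.a_assoc)
  next
    show "\<zero>\<^bsub>M\<^esub> \<in> carrier M" using z c by simp
  next
    fix u assume "u \<in> carrier M"
    then obtain x where x: "x \<in> carrier S" "u = \<pi> x" using c by blast
    show "\<zero>\<^bsub>M\<^esub> \<oplus>\<^bsub>M\<^esub> u = u" using x a z by simp
    have "\<pi> (\<ominus>\<^bsub>S\<^esub> x) \<oplus>\<^bsub>M\<^esub> u = \<zero>\<^bsub>M\<^esub>" using x a z by (simp add: S.l_neg)
    thus "\<exists>v\<in>carrier M. v \<oplus>\<^bsub>M\<^esub> u = \<zero>\<^bsub>M\<^esub>" using x c by auto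
  qed
  moreover have "cring R" by (rule S.is_cring)
  ultimately have "module R M"
  proof (intro moduleI)
    fix r t u v
    assume r: "r \<in> carrier R" and t: "t \<in> carrier R" and u: "u \<in> carrier M" and v: "v \<in> carrier M"
    obtain x y where xy: "x \<in> carrier S" "u = \<pi> x" "y \<in> carrier S" "v = \<pi> y" using u v c by blast
    show "r \<odot>\<^bsub>M\<^esub> u \<in> carrier M" using xy r s c by simp
    show "(r \<oplus>\<^bsub>R\<^esub> t) \<odot>\<^bsub>M\<^esub> u = r \<odot>\<^bsub>M\<^esub> u \<oplus>\<^bsub>M\<^esub> t \<odot>\<^bsub>M\<^esub> u"
      using xy r t a s by (simp add: S.smult_l_distr)
    show "r \<odot>\<^bsub>M\<^esub> (u \<oplus>\<^bsub>M\<^esub> v) = r \<odot>\<^bsub>M\<^esub> u \<oplus>\<^bsub>M\<^esub> r \<odot>\<^bsub>M\<^esub> v"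
      using xy r a s by (simp add: S.smult_r_distr)
    show "(r \<otimes>\<^bsub>R\<^esub> t) \<odot>\<^bsub>M\<^esub> u = r \<odot>\<^bsub>M\<^esub> (t \<odot>\<^bsub>M\<^esub> u)"
      using xy r t s by (simp add: S.smult_assoc1)
  next
    fix u assume "u \<in> carrier M"
    then obtain x where "x \<in> carrier S" "u = \<pi> x" using c by blast
    thus "\<one>\<^bsub>R\<^esub> \<odot>\<^bsub>M\<^esub> u = u" using s by simp
  qed
  moreover have "\<pi> \<in> module_hom R S M"
    unfolding module_hom_def hom_def using c a s by auto
  ultimately show ?thesis using that c by blast
qed

lemma quotient_embedding:
  fixes S :: "('r, 's, 'x) module_scheme" and \<iota> :: "'e \<Rightarrow> 's"
  assumes S: "module R S" and K: "submodule K R S"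
    and ess: "\<And>s. s \<in> carrier S - K \<Longrightarrow>
      \<exists>r\<in>carrier R. \<exists>k\<in>K. \<exists>e. \<iota> e \<notin> K \<and> r \<odot>\<^bsub>S\<^esub> s = \<iota> e \<oplus>\<^bsub>S\<^esub> k \<and> \<iota> e \<in> carrier S"
  obtains \<pi> :: "'s \<Rightarrow> ('r \<times> 'e) rel"
  where "\<And>x y. x \<in> carrier S \<Longrightarrow> y \<in> carrier S \<Longrightarrow> \<pi> x = \<pi> y \<longleftrightarrow> x \<ominus>\<^bsub>S\<^esub> y \<in> K"
proof -
  interpret S: module R S by (rule S)
  note KE = S.submoduleE[OF K]
  have zK: "\<zero>\<^bsub>S\<^esub> \<in> K" using subgroup.one_closed[OF submodule.axioms(1)[OF K]] by simp
  have mm: "x \<ominus>\<^bsub>S\<^esub> z = (x \<ominus>\<^bsub>S\<^esub> y) \<oplus>\<^bsub>S\<^esub> (y \<ominus>\<^bsub>S\<^esub> z)"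
    if "x \<in> carrier S" "y \<in> carrier S" "z \<in> carrier S" for x y z
    using that by (simp add: S.minus_eq S.a_assoc S.r_neg1)
  define eq where "eq x y \<longleftrightarrow> x \<in> carrier S \<and> y \<in> carrier S \<and> x \<ominus>\<^bsub>S\<^esub> y \<in> K" for x y
  have refl: "x \<in> carrier S \<Longrightarrow> eq x x" for x
    using zK by (simp add: eq_def S.minus_eq S.r_neg)
  have sym: "eq x y \<Longrightarrow> eq y x" for x y
  proof -
    assume e: "eq x y"
    hence "y \<ominus>\<^bsub>S\<^esub> x = \<ominus>\<^bsub>S\<^esub> (x \<ominus>\<^bsub>S\<^esub> y)"
      by (simp add: eq_def S.minus_eq S.minus_add S.a_comm)
    thus "eq y x" using e KE(3) by (auto simp: eq_def)
  qed
  have tr: "eq x y \<Longrightarrow> eq y z \<Longrightarrow> eq x z" for x y z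
    using mm[of x y z] KE(5) by (auto simp: eq_def)
  define \<rho> where "\<rho> x = (SOME y. eq y x)" for x
  have \<rho>: "eq (\<rho> x) x" if "x \<in> carrier S" for x
    unfolding \<rho>_def by (rule someI[of "\<lambda>y. eq y x"]) (rule refl[OF that])
  have \<rho>eq: "\<rho> x = \<rho> y \<longleftrightarrow> eq x y" if "x \<in> carrier S" "y \<in> carrier S" for x y
  proof
    assume "\<rho> x = \<rho> y"
    thus "eq x y" using \<rho>[OF that(1)] \<rho>[OF that(2)] sym tr by metis
  next
    assume "eq x y"
    hence "eq z x = eq z y" for z using sym tr by blast
    thus "\<rho> x = \<rho> y" unfolding \<rho>_def by simp
  qed
  define good where "good c s \<longleftrightarrow> fst c \<in> carrier R \<and> \<iota> (snd c) \<notin> K \<and> \<iota> (snd c) \<in> carrier S \<and>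
    (\<exists>k\<in>K. fst c \<odot>\<^bsub>S\<^esub> s = \<iota> (snd c) \<oplus>\<^bsub>S\<^esub> k)" for c s
  define c where "c x y = (SOME c. good c (x \<ominus>\<^bsub>S\<^esub> y))" for x y
  have c: "good (c x y) (x \<ominus>\<^bsub>S\<^esub> y)" if "x \<in> carrier S" "y \<in> carrier S" "\<not> eq x y" for x y
  proof -
    have "x \<ominus>\<^bsub>S\<^esub> y \<in> carrier S - K" using that by (auto simp: eq_def)
    from ess[OF this] have "\<exists>c. good c (x \<ominus>\<^bsub>S\<^esub> y)" unfolding good_def by force
    thus ?thesis unfolding c_def by (rule someI_ex)
  qed
  have "\<exists>\<phi> :: 's \<Rightarrow> ('r \<times> 'e) rel. inj_on \<phi> (\<rho> ` carrier S)"
  proof (rule triangle_free_inj[where c = c])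
    fix x y z assume P: "x \<in> \<rho> ` carrier S" "y \<in> \<rho> ` carrier S" "z \<in> \<rho> ` carrier S"
      and ne: "x \<noteq> y" "y \<noteq> z" "x \<noteq> z" and cc: "c x y = c y z" "c x z = c y z"
    have C: "x \<in> carrier S" "y \<in> carrier S" "z \<in> carrier S" using P \<rho> by (auto simp: eq_def)
    have neq: "\<not> eq u v" if "u \<in> \<rho> ` carrier S" "v \<in> \<rho> ` carrier S" "u \<noteq> v" for u v
    proof
      assume uv: "eq u v"
      obtain p q where pq: "p \<in> carrier S" "q \<in> carrier S" "u = \<rho> p" "v = \<rho> q" using \<open>u \<in> _\<close> \<open>v \<in> _\<close> by blast
      have "eq p u" "eq v q" using \<rho> pq sym by auto
      hence "eq p q" using uv tr by blast
      thus False using \<rho>eq pq \<open>u \<noteq> v\<close> by blast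
    qed
    obtain r e where re: "c y z = (r, e)" by fastforce
    have g: "good (r, e) (x \<ominus>\<^bsub>S\<^esub> y)" "good (r, e) (y \<ominus>\<^bsub>S\<^esub> z)" "good (r, e) (x \<ominus>\<^bsub>S\<^esub> z)"
      using c[OF C(1,2) neq[OF P(1,2) ne(1)]] c[OF C(2,3) neq[OF P(2,3) ne(2)]]
        c[OF C(1,3) neq[OF P(1,3) ne(3)]] cc re by simp_all
    have r: "r \<in> carrier R" and b: "\<iota> e \<in> carrier S" "\<iota> e \<notin> K" using g(1) by (auto simp: good_def)
    obtain k1 k2 k3 where k: "k1 \<in> K" "k2 \<in> K" "k3 \<in> K"
      and eqs: "r \<odot>\<^bsub>S\<^esub> (x \<ominus>\<^bsub>S\<^esub> y) = \<iota> e \<oplus>\<^bsub>S\<^esub> k1" "r \<odot>\<^bsub>S\<^esub> (y \<ominus>\<^bsub>S\<^esub> z) = \<iota> e \<oplus>\<^bsub>S\<^esub> k2"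
        "r \<odot>\<^bsub>S\<^esub> (x \<ominus>\<^bsub>S\<^esub> z) = \<iota> e \<oplus>\<^bsub>S\<^esub> k3"
      using g unfolding good_def by auto
    have kc: "k1 \<in> carrier S" "k2 \<in> carrier S" "k3 \<in> carrier S" using k KE(1) by auto
    have "r \<odot>\<^bsub>S\<^esub> (x \<ominus>\<^bsub>S\<^esub> z) = r \<odot>\<^bsub>S\<^esub> (x \<ominus>\<^bsub>S\<^esub> y) \<oplus>\<^bsub>S\<^esub> r \<odot>\<^bsub>S\<^esub> (y \<ominus>\<^bsub>S\<^esub> z)"
      using mm[OF C] S.smult_r_distr r C by simp
    hence "\<iota> e \<oplus>\<^bsub>S\<^esub> k3 = (\<iota> e \<oplus>\<^bsub>S\<^esub> k1) \<oplus>\<^bsub>S\<^esub> (\<iota> e \<oplus>\<^bsub>S\<^esub> k2)" using eqs by simp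
    also have "\<dots> = \<iota> e \<oplus>\<^bsub>S\<^esub> (k1 \<oplus>\<^bsub>S\<^esub> (\<iota> e \<oplus>\<^bsub>S\<^esub> k2))" using b kc by (simp add: S.a_assoc)
    finally have "k3 = k1 \<oplus>\<^bsub>S\<^esub> (\<iota> e \<oplus>\<^bsub>S\<^esub> k2)" using b kc by simp
    also have "\<dots> = \<iota> e \<oplus>\<^bsub>S\<^esub> (k1 \<oplus>\<^bsub>S\<^esub> k2)" using b kc S.a_lcomm by simp
    finally have "k3 \<ominus>\<^bsub>S\<^esub> (k1 \<oplus>\<^bsub>S\<^esub> k2) = \<iota> e"
      using b kc by (simp add: S.minus_eq S.a_assoc S.r_neg)
    moreover have "k3 \<ominus>\<^bsub>S\<^esub> (k1 \<oplus>\<^bsub>S\<^esub> k2) \<in> K" using KE k by (simp add: S.minus_eq)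
    ultimately show False using b by simp
  qed
  then obtain \<phi> :: "'s \<Rightarrow> ('r \<times> 'e) rel" where "inj_on \<phi> (\<rho> ` carrier S)" ..
  hence "(\<phi> \<circ> \<rho>) x = (\<phi> \<circ> \<rho>) y \<longleftrightarrow> x \<ominus>\<^bsub>S\<^esub> y \<in> K" if "x \<in> carrier S" "y \<in> carrier S" for x y
    using \<rho>eq[OF that] that by (auto simp: inj_on_def eq_def)
  thus ?thesis using that by blast
qed

lemma maximal_submodule:
  fixes S :: "('r, 's, 'x) module_scheme"
  assumes S: "module R S" and N: "submodule N R S" and NB: "N \<inter> B \<subseteq> {\<zero>\<^bsub>S\<^esub>}"
  obtains K where "submodule K R S" "N \<subseteq> K" "K \<inter> B \<subseteq> {\<zero>\<^bsub>S\<^esub>}"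
    "\<And>s. s \<in> carrier S - K \<Longrightarrow>
      \<exists>r\<in>carrier R. \<exists>k\<in>K. \<exists>b\<in>B. b \<noteq> \<zero>\<^bsub>S\<^esub> \<and> r \<odot>\<^bsub>S\<^esub> s = b \<oplus>\<^bsub>S\<^esub> k"
proof -
  interpret S: module R S by (rule S)
  define F where "F = {K. submodule K R S \<and> N \<subseteq> K \<and> K \<inter> B \<subseteq> {\<zero>\<^bsub>S\<^esub>}}"
  have zero: "\<zero>\<^bsub>S\<^esub> \<in> K" if "submodule K R S" for K
    using subgroup.one_closed[OF submodule.axioms(1)[OF that]] by simp
  have "\<exists>K\<in>F. \<forall>L\<in>F. K \<subseteq> L \<longrightarrow> L = K"
  proof (rule subset_Zorn_nonempty)
    show "F \<noteq> {}" using N NB unfolding F_def by blast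
  next
    fix C assume C: "C \<noteq> {}" "subset.chain F C"
    hence CF: "C \<subseteq> F" by (simp add: subset_chain_def)
    have "submodule (\<Union>C) R S"
    proof (rule S.submoduleI)
      show "\<Union>C \<subseteq> carrier S" using CF S.submoduleE(1) unfolding F_def by blast
      show "\<zero>\<^bsub>S\<^esub> \<in> \<Union>C" using C CF zero unfolding F_def by blast
      show "\<ominus>\<^bsub>S\<^esub> x \<in> \<Union>C" if "x \<in> \<Union>C" for x
        using that CF S.submoduleE(3) unfolding F_def by blast
      show "r \<odot>\<^bsub>S\<^esub> x \<in> \<Union>C" if "r \<in> carrier R" "x \<in> \<Union>C" for r x
        using that CF S.submoduleE(4) unfolding F_def by blast
      show "x \<oplus>\<^bsub>S\<^esub> y \<in> \<Union>C" if xy: "x \<in> \<Union>C" "y \<in> \<Union>C" for x y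
      proof -
        obtain L where L: "L \<in> C" "x \<in> L" "y \<in> L" using xy C(2) unfolding subset_chain_def by blast
        hence "submodule L R S" using CF unfolding F_def by blast
        thus ?thesis using S.submoduleE(5) L by blast
      qed
    qed
    thus "\<Union>C \<in> F" using C CF unfolding F_def by blast
  qed
  then obtain K where KF: "K \<in> F" and max: "\<And>L. L \<in> F \<Longrightarrow> K \<subseteq> L \<Longrightarrow> L = K" by blast
  have K: "submodule K R S" using KF by (simp add: F_def)
  note KE = S.submoduleE[OF K]
  have "\<exists>r\<in>carrier R. \<exists>k\<in>K. \<exists>b\<in>B. b \<noteq> \<zero>\<^bsub>S\<^esub> \<and> r \<odot>\<^bsub>S\<^esub> s = b \<oplus>\<^bsub>S\<^esub> k"
    if s: "s \<in> carrier S - K" for s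
  proof -
    define L where "L = {r \<odot>\<^bsub>S\<^esub> s \<oplus>\<^bsub>S\<^esub> k | r k. r \<in> carrier R \<and> k \<in> K}"
    have I: "r \<in> carrier R \<Longrightarrow> k \<in> K \<Longrightarrow> x = r \<odot>\<^bsub>S\<^esub> s \<oplus>\<^bsub>S\<^esub> k \<Longrightarrow> x \<in> L" for r k x
      unfolding L_def by blast
    have sc: "s \<in> carrier S" using s by simp
    have kc: "k \<in> K \<Longrightarrow> k \<in> carrier S" for k using KE(1) by blast
    have "submodule L R S"
    proof (rule S.submoduleI)
      show "L \<subseteq> carrier S" unfolding L_def using sc kc by auto
      show "\<zero>\<^bsub>S\<^esub> \<in> L" by (rule I[of "\<zero>\<^bsub>R\<^esub>" "\<zero>\<^bsub>S\<^esub>"]) (use sc zero[OF K] in auto)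
    next
      fix x assume "x \<in> L"
      then obtain r k where x: "r \<in> carrier R" "k \<in> K" "x = r \<odot>\<^bsub>S\<^esub> s \<oplus>\<^bsub>S\<^esub> k" unfolding L_def by blast
      show "\<ominus>\<^bsub>S\<^esub> x \<in> L"
        by (rule I[of "\<ominus>\<^bsub>R\<^esub> r" "\<ominus>\<^bsub>S\<^esub> k"]) (use x sc kc KE in \<open>auto simp: S.smult_l_minus S.minus_add\<close>)
      show "t \<odot>\<^bsub>S\<^esub> x \<in> L" if "t \<in> carrier R" for t
        by (rule I[of "t \<otimes>\<^bsub>R\<^esub> r" "t \<odot>\<^bsub>S\<^esub> k"])
          (use x sc kc KE that in \<open>auto simp: S.smult_r_distr S.smult_assoc1\<close>)
      fix y assume "y \<in> L"
      then obtain r' k' where y: "r' \<in> carrier R" "k' \<in> K" "y = r' \<odot>\<^bsub>S\<^esub> s \<oplus>\<^bsub>S\<^esub> k'" unfolding L_def by blast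
      show "x \<oplus>\<^bsub>S\<^esub> y \<in> L"
        by (rule I[of "r \<oplus>\<^bsub>R\<^esub> r'" "k \<oplus>\<^bsub>S\<^esub> k'"])
          (use x y sc kc KE in \<open>auto simp: S.smult_l_distr S.a_ac\<close>)
    qed
    moreover have KL: "K \<subseteq> L"
    proof
      fix k assume "k \<in> K"
      thus "k \<in> L" by (intro I[of "\<zero>\<^bsub>R\<^esub>" k]) (use sc kc in auto)
    qed
    moreover have "s \<in> L" by (rule I[of "\<one>\<^bsub>R\<^esub>" "\<zero>\<^bsub>S\<^esub>"]) (use sc zero[OF K] in auto)
    ultimately have "\<not> L \<inter> B \<subseteq> {\<zero>\<^bsub>S\<^esub>}" using max[of L] KF s unfolding F_def by blast
    then obtain b where b: "b \<in> L" "b \<in> B" "b \<noteq> \<zero>\<^bsub>S\<^esub>" by blast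
    then obtain r k where x: "r \<in> carrier R" "k \<in> K" "b = r \<odot>\<^bsub>S\<^esub> s \<oplus>\<^bsub>S\<^esub> k" unfolding L_def by blast
    have "r \<odot>\<^bsub>S\<^esub> s = b \<oplus>\<^bsub>S\<^esub> (\<ominus>\<^bsub>S\<^esub> k)" using x sc kc by (simp add: S.a_assoc S.r_neg)
    thus ?thesis using x b KE(3) by blast
  qed
  thus ?thesis using that KF unfolding F_def by blast
qed

lemma module_homD:
  assumes "f \<in> module_hom R M N"
  shows "\<And>x. x \<in> carrier M \<Longrightarrow> f x \<in> carrier N"
    and "\<And>x y. x \<in> carrier M \<Longrightarrow> y \<in> carrier M \<Longrightarrow> f (x \<oplus>\<^bsub>M\<^esub> y) = f x \<oplus>\<^bsub>N\<^esub> f y"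
    and "\<And>r x. r \<in> carrier R \<Longrightarrow> x \<in> carrier M \<Longrightarrow> f (r \<odot>\<^bsub>M\<^esub> x) = r \<odot>\<^bsub>N\<^esub> f x"
  using assms by (auto simp: module_hom_def hom_def)

lemma module_homI:
  assumes "\<And>x y. x \<in> carrier M \<Longrightarrow> y \<in> carrier M \<Longrightarrow> f x \<in> carrier N"
    and "\<And>x y. x \<in> carrier M \<Longrightarrow> y \<in> carrier M \<Longrightarrow> f (x \<oplus>\<^bsub>M\<^esub> y) = f x \<oplus>\<^bsub>N\<^esub> f y"
    and "\<And>r x. r \<in> carrier R \<Longrightarrow> x \<in> carrier M \<Longrightarrow> f (r \<odot>\<^bsub>M\<^esub> x) = r \<odot>\<^bsub>N\<^esub> f x"
  shows "f \<in> module_hom R M N"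
  using assms by (auto simp: module_hom_def hom_def)

lemma module_hom_zero:
  assumes "module R M" "module R N" "f \<in> module_hom R M N"
  shows "f \<zero>\<^bsub>M\<^esub> = \<zero>\<^bsub>N\<^esub>"
proof -
  interpret M: module R M by fact
  interpret N: module R N by fact
  have "f \<zero>\<^bsub>M\<^esub> = f (\<zero>\<^bsub>R\<^esub> \<odot>\<^bsub>M\<^esub> \<zero>\<^bsub>M\<^esub>)" by simp
  also have "\<dots> = \<zero>\<^bsub>R\<^esub> \<odot>\<^bsub>N\<^esub> f \<zero>\<^bsub>M\<^esub>"
    by (rule module_homD(3)[OF assms(3)]) simp_all
  also have "\<dots> = \<zero>\<^bsub>N\<^esub>" by (rule N.smult_l_null[OF module_homD(1)[OF assms(3)]]) simp
  finally show ?thesis .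
qed

lemma module_hom_minus:
  assumes "module R M" "module R N" "f \<in> module_hom R M N" "x \<in> carrier M"
  shows "f (\<ominus>\<^bsub>M\<^esub> x) = \<ominus>\<^bsub>N\<^esub> f x"
proof -
  interpret M: module R M by fact
  interpret N: module R N by fact
  note h = module_homD[OF assms(3)]
  have "f (\<ominus>\<^bsub>M\<^esub> x) \<oplus>\<^bsub>N\<^esub> f x = f (\<ominus>\<^bsub>M\<^esub> x \<oplus>\<^bsub>M\<^esub> x)" using h(2) assms(4) by simp
  also have "\<dots> = \<zero>\<^bsub>N\<^esub>"
    using module_hom_zero[OF assms(1-3)] assms(4) by (simp add: M.l_neg)
  finally show ?thesis using N.minus_equality h(1) assms(4) by simp
qed

lemma e_injective_all_types:
  fixes E :: "('r, 'e) module" and A1 :: "('r, 'c, 'x) module_scheme"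
    and A2 :: "('r, 'd, 'y) module_scheme"
  assumes E: "e_injective R E" and A1: "module R A1" and A2: "module R A2"
    and f1: "f1 \<in> module_hom R A1 A2" and inj: "inj_on f1 (carrier A1)"
    and f2: "f2 \<in> module_hom R A1 E"
  shows "\<exists>r\<in>carrier R - {\<zero>\<^bsub>R\<^esub>}. \<exists>f3\<in>module_hom R A2 E.
           \<forall>x\<in>carrier A1. f3 (f1 x) = r \<odot>\<^bsub>E\<^esub> f2 x"
proof -
  have mE: "module R E" using E unfolding e_injective_def by blast
  interpret E: module R E by (rule mE)
  interpret A1: module R A1 by (rule A1)
  interpret A2: module R A2 by (rule A2)
  note h1 = module_homD[OF f1] and h2 = module_homD[OF f2]
  have z1: "f1 \<zero>\<^bsub>A1\<^esub> = \<zero>\<^bsub>A2\<^esub>" by (rule module_hom_zero[OF A1 A2 f1])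
  have z2: "f2 \<zero>\<^bsub>A1\<^esub> = \<zero>\<^bsub>E\<^esub>" by (rule module_hom_zero[OF A1 mE f2])
  have m1: "f1 (\<ominus>\<^bsub>A1\<^esub> x) = \<ominus>\<^bsub>A2\<^esub> f1 x" if "x \<in> carrier A1" for x
    by (rule module_hom_minus[OF A1 A2 f1 that])
  have m2: "f2 (\<ominus>\<^bsub>A1\<^esub> x) = \<ominus>\<^bsub>E\<^esub> f2 x" if "x \<in> carrier A1" for x
    by (rule module_hom_minus[OF A1 mE f2 that])
  define S :: "('r, 'e \<times> 'd) module" where "S = \<lparr>carrier = carrier E \<times> carrier A2,
    monoid.mult = (\<lambda>p q. p), one = (\<zero>\<^bsub>E\<^esub>, \<zero>\<^bsub>A2\<^esub>), zero = (\<zero>\<^bsub>E\<^esub>, \<zero>\<^bsub>A2\<^esub>),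
    add = (\<lambda>p q. (fst p \<oplus>\<^bsub>E\<^esub> fst q, snd p \<oplus>\<^bsub>A2\<^esub> snd q)),
    smult = (\<lambda>r p. (r \<odot>\<^bsub>E\<^esub> fst p, r \<odot>\<^bsub>A2\<^esub> snd p))\<rparr>"
  have Sc: "carrier S = carrier E \<times> carrier A2" and Sz: "\<zero>\<^bsub>S\<^esub> = (\<zero>\<^bsub>E\<^esub>, \<zero>\<^bsub>A2\<^esub>)"
    and Sa: "\<And>x y x' y'. (x, y) \<oplus>\<^bsub>S\<^esub> (x', y') = (x \<oplus>\<^bsub>E\<^esub> x', y \<oplus>\<^bsub>A2\<^esub> y')"
    and Ss: "\<And>r x y. r \<odot>\<^bsub>S\<^esub> (x, y) = (r \<odot>\<^bsub>E\<^esub> x, r \<odot>\<^bsub>A2\<^esub> y)"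
    unfolding S_def by simp_all
  have aS: "abelian_group S"
  proof (rule abelian_groupI)
    fix p assume "p \<in> carrier S"
    then obtain x y where p: "p = (x, y)" "x \<in> carrier E" "y \<in> carrier A2" using Sc by blast
    have "(\<ominus>\<^bsub>E\<^esub> x, \<ominus>\<^bsub>A2\<^esub> y) \<oplus>\<^bsub>S\<^esub> p = \<zero>\<^bsub>S\<^esub>" using p by (simp add: Sa Sz E.l_neg A2.l_neg)
    thus "\<exists>q\<in>carrier S. q \<oplus>\<^bsub>S\<^esub> p = \<zero>\<^bsub>S\<^esub>"
      by (rule bexI) (use p Sc in auto)
  qed (auto simp: Sc Sz Sa E.a_ac A2.a_ac)
  have mS: "module R S"
    by (rule moduleI[OF E.is_cring aS])
      (auto simp: Sc Sa Ss E.smult_l_distr A2.smult_l_distr E.smult_r_distr A2.smult_r_distr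
        E.smult_assoc1 A2.smult_assoc1)
  interpret S: module R S by (rule mS)
  have Sm: "\<ominus>\<^bsub>S\<^esub> (x, y) = (\<ominus>\<^bsub>E\<^esub> x, \<ominus>\<^bsub>A2\<^esub> y)" if "x \<in> carrier E" "y \<in> carrier A2" for x y
    by (rule S.minus_equality) (use that in \<open>auto simp: Sc Sa Sz E.l_neg A2.l_neg\<close>)
  have mz: "\<ominus>\<^bsub>A2\<^esub> \<zero>\<^bsub>A2\<^esub> = \<zero>\<^bsub>A2\<^esub>" by (rule A2.minus_equality) simp_all
  define N where "N = (\<lambda>a. (f2 a, \<ominus>\<^bsub>A2\<^esub> f1 a)) ` carrier A1"
  have NI: "a \<in> carrier A1 \<Longrightarrow> p = (f2 a, \<ominus>\<^bsub>A2\<^esub> f1 a) \<Longrightarrow> p \<in> N" for a p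
    unfolding N_def by blast
  have N: "submodule N R S"
  proof (rule S.submoduleI)
    show "N \<subseteq> carrier S" unfolding N_def Sc using h1 h2 by auto
    show "\<zero>\<^bsub>S\<^esub> \<in> N" by (rule NI[of "\<zero>\<^bsub>A1\<^esub>"]) (auto simp: Sz z1 z2 mz)
  next
    fix p assume "p \<in> N"
    then obtain a where a: "a \<in> carrier A1" "p = (f2 a, \<ominus>\<^bsub>A2\<^esub> f1 a)" unfolding N_def by blast
    show "\<ominus>\<^bsub>S\<^esub> p \<in> N"
      by (rule NI[of "\<ominus>\<^bsub>A1\<^esub> a"]) (use a h1 h2 in \<open>auto simp: Sm m1 m2\<close>)
    show "r \<odot>\<^bsub>S\<^esub> p \<in> N" if "r \<in> carrier R" for r
      by (rule NI[of "r \<odot>\<^bsub>A1\<^esub> a"]) (use a h1 h2 that in \<open>auto simp: Ss A2.smult_r_minus\<close>)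
    fix q assume "q \<in> N"
    then obtain b where b: "b \<in> carrier A1" "q = (f2 b, \<ominus>\<^bsub>A2\<^esub> f1 b)" unfolding N_def by blast
    show "p \<oplus>\<^bsub>S\<^esub> q \<in> N"
      by (rule NI[of "a \<oplus>\<^bsub>A1\<^esub> b"]) (use a b h1 h2 in \<open>auto simp: Sa A2.minus_add\<close>)
  qed
  define \<iota> where "\<iota> e = (e, \<zero>\<^bsub>A2\<^esub>)" for e :: 'e
  have NB: "N \<inter> \<iota> ` carrier E \<subseteq> {\<zero>\<^bsub>S\<^esub>}"
  proof
    fix p assume "p \<in> N \<inter> \<iota> ` carrier E"
    then obtain a e where a: "a \<in> carrier A1" "p = (f2 a, \<ominus>\<^bsub>A2\<^esub> f1 a)" "p = (e, \<zero>\<^bsub>A2\<^esub>)"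
      unfolding N_def \<iota>_def by blast
    have "f1 a = \<ominus>\<^bsub>A2\<^esub> (\<ominus>\<^bsub>A2\<^esub> f1 a)" using h1(1)[OF a(1)] by simp
    also have "\<dots> = f1 \<zero>\<^bsub>A1\<^esub>" using a z1 mz by simp
    finally have "a = \<zero>\<^bsub>A1\<^esub>" using inj a(1) by (simp add: inj_on_eq_iff)
    thus "p \<in> {\<zero>\<^bsub>S\<^esub>}" using a z1 z2 Sz by simp
  qed
  obtain K where K: "submodule K R S" "N \<subseteq> K" "K \<inter> \<iota> ` carrier E \<subseteq> {\<zero>\<^bsub>S\<^esub>}"
    and max: "\<And>s. s \<in> carrier S - K \<Longrightarrow>
      \<exists>r\<in>carrier R. \<exists>k\<in>K. \<exists>b\<in>\<iota> ` carrier E. b \<noteq> \<zero>\<^bsub>S\<^esub> \<and> r \<odot>\<^bsub>S\<^esub> s = b \<oplus>\<^bsub>S\<^esub> k"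
    using maximal_submodule[OF mS N NB] by metis
  note KE = S.submoduleE[OF K(1)]
  have \<iota>c: "e \<in> carrier E \<Longrightarrow> \<iota> e \<in> carrier S" for e unfolding \<iota>_def Sc by simp
  obtain \<pi> :: "'e \<times> 'd \<Rightarrow> ('r \<times> 'e) rel"
    where \<pi>: "\<And>x y. x \<in> carrier S \<Longrightarrow> y \<in> carrier S \<Longrightarrow> \<pi> x = \<pi> y \<longleftrightarrow> x \<ominus>\<^bsub>S\<^esub> y \<in> K"
  proof (rule quotient_embedding[OF mS K(1), of \<iota>])
    fix s assume "s \<in> carrier S - K"
    then obtain r k e where re: "r \<in> carrier R" "k \<in> K" "e \<in> carrier E" "\<iota> e \<noteq> \<zero>\<^bsub>S\<^esub>"
        "r \<odot>\<^bsub>S\<^esub> s = \<iota> e \<oplus>\<^bsub>S\<^esub> k"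
      using max by blast
    have "\<iota> e \<notin> K" using K(3) re by blast
    thus "\<exists>r\<in>carrier R. \<exists>k\<in>K. \<exists>e. \<iota> e \<notin> K \<and> r \<odot>\<^bsub>S\<^esub> s = \<iota> e \<oplus>\<^bsub>S\<^esub> k \<and> \<iota> e \<in> carrier S"
      using re \<iota>c by blast
  qed blast
  obtain P :: "('r, ('r \<times> 'e) rel) module"
    where P: "module R P" "carrier P = \<pi> ` carrier S" "\<pi> \<in> module_hom R S P"
  proof (rule image_module[OF mS, of \<pi>])
    fix x y x' y' assume c: "x \<in> carrier S" "y \<in> carrier S" "x' \<in> carrier S" "y' \<in> carrier S"
      and e: "\<pi> x = \<pi> x'" "\<pi> y = \<pi> y'"
    have "(x \<ominus>\<^bsub>S\<^esub> x') \<oplus>\<^bsub>S\<^esub> (y \<ominus>\<^bsub>S\<^esub> y') \<in> K" using KE(5) \<pi> c e by simp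
    also have "(x \<ominus>\<^bsub>S\<^esub> x') \<oplus>\<^bsub>S\<^esub> (y \<ominus>\<^bsub>S\<^esub> y') = (x \<oplus>\<^bsub>S\<^esub> y) \<ominus>\<^bsub>S\<^esub> (x' \<oplus>\<^bsub>S\<^esub> y')"
      using c by (simp add: S.minus_eq S.minus_add S.a_ac)
    finally show "\<pi> (x \<oplus>\<^bsub>S\<^esub> y) = \<pi> (x' \<oplus>\<^bsub>S\<^esub> y')" using \<pi> c by simp
  next
    fix r x x' assume c: "r \<in> carrier R" "x \<in> carrier S" "x' \<in> carrier S" and e: "\<pi> x = \<pi> x'"
    have "r \<odot>\<^bsub>S\<^esub> (x \<ominus>\<^bsub>S\<^esub> x') \<in> K" using KE(4) \<pi> c e by simp
    also have "r \<odot>\<^bsub>S\<^esub> (x \<ominus>\<^bsub>S\<^esub> x') = (r \<odot>\<^bsub>S\<^esub> x) \<ominus>\<^bsub>S\<^esub> (r \<odot>\<^bsub>S\<^esub> x')"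
      using c by (simp add: S.minus_eq S.smult_r_distr S.smult_r_minus)
    finally show "\<pi> (r \<odot>\<^bsub>S\<^esub> x) = \<pi> (r \<odot>\<^bsub>S\<^esub> x')" using \<pi> c by simp
  qed blast
  note hP = module_homD[OF P(3)]
  define j where "j e = \<pi> (\<iota> e)" for e
  have jinj: "inj_on j (carrier E)"
  proof (rule inj_onI)
    fix e e' assume e: "e \<in> carrier E" "e' \<in> carrier E" "j e = j e'"
    have "\<iota> e \<ominus>\<^bsub>S\<^esub> \<iota> e' \<in> K" using e \<pi> \<iota>c unfolding j_def by simp
    moreover have "\<iota> e \<ominus>\<^bsub>S\<^esub> \<iota> e' = \<iota> (e \<ominus>\<^bsub>E\<^esub> e')"
      using e unfolding \<iota>_def S.minus_eq E.minus_eq by (simp add: Sm Sa mz)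
    ultimately have "\<iota> (e \<ominus>\<^bsub>E\<^esub> e') = \<zero>\<^bsub>S\<^esub>" using K(3) e by auto
    hence z: "e \<ominus>\<^bsub>E\<^esub> e' = \<zero>\<^bsub>E\<^esub>" by (simp add: \<iota>_def Sz)
    have "e = (e \<ominus>\<^bsub>E\<^esub> e') \<oplus>\<^bsub>E\<^esub> e'" using e by (simp add: E.minus_eq E.a_assoc E.l_neg)
    thus "e = e'" using e z by simp
  qed
  have jh: "j (x \<oplus>\<^bsub>E\<^esub> y) = j x \<oplus>\<^bsub>P\<^esub> j y" if "x \<in> carrier E" "y \<in> carrier E" for x y
    using hP(2)[OF \<iota>c[OF that(1)] \<iota>c[OF that(2)]] unfolding j_def by (simp add: \<iota>_def Sa)
  have js: "j (r \<odot>\<^bsub>E\<^esub> x) = r \<odot>\<^bsub>P\<^esub> j x" if "r \<in> carrier R" "x \<in> carrier E" for r x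
    using hP(3)[OF that(1) \<iota>c[OF that(2)]] that unfolding j_def by (simp add: \<iota>_def Ss)
  have jc: "x \<in> carrier E \<Longrightarrow> j x \<in> carrier P" for x using hP(1) \<iota>c unfolding j_def by blast
  obtain Q :: "('r, ('r \<times> 'e) rel) module"
    where Q: "module R Q" "carrier Q = j ` carrier E" "j \<in> module_hom R E Q"
  proof (rule image_module[OF mE, of j])
    fix x y x' y' assume "x \<in> carrier E" "y \<in> carrier E" "x' \<in> carrier E" "y' \<in> carrier E"
      "j x = j x'" "j y = j y'"
    thus "j (x \<oplus>\<^bsub>E\<^esub> y) = j (x' \<oplus>\<^bsub>E\<^esub> y')" by (simp add: jh)
  next
    fix r x x' assume "r \<in> carrier R" "x \<in> carrier E" "x' \<in> carrier E" "j x = j x'"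
    thus "j (r \<odot>\<^bsub>E\<^esub> x) = j (r \<odot>\<^bsub>E\<^esub> x')" by (simp add: js)
  qed blast
  note hQ = module_homD[OF Q(3)]
  define i where "i = inv_into (carrier E) j"
  have i: "i (j x) = x" if "x \<in> carrier E" for x
    unfolding i_def using jinj that by simp
  have gQ: "\<exists>x\<in>carrier E. u = j x" if "u \<in> carrier Q" for u using that Q(2) by blast
  have "(\<lambda>u. u) \<in> module_hom R Q P"
  proof (rule module_homI)
    fix u v assume uv: "u \<in> carrier Q" "v \<in> carrier Q"
    obtain x y where xy: "x \<in> carrier E" "y \<in> carrier E" "u = j x" "v = j y" using gQ uv by blast
    show "u \<in> carrier P" using xy jc by simp
    show "u \<oplus>\<^bsub>Q\<^esub> v = u \<oplus>\<^bsub>P\<^esub> v" using xy jh hQ(2) by metis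
  next
    fix r u assume r: "r \<in> carrier R" and u: "u \<in> carrier Q"
    obtain x where x: "x \<in> carrier E" "u = j x" using gQ u by blast
    show "r \<odot>\<^bsub>Q\<^esub> u = r \<odot>\<^bsub>P\<^esub> u" using x r js hQ(3) by metis
  qed
  moreover have "i \<in> module_hom R Q E"
  proof (rule module_homI)
    fix u v assume uv: "u \<in> carrier Q" "v \<in> carrier Q"
    obtain x y where xy: "x \<in> carrier E" "y \<in> carrier E" "u = j x" "v = j y" using gQ uv by blast
    show "i u \<in> carrier E" using xy i by simp
    have "u \<oplus>\<^bsub>Q\<^esub> v = j (x \<oplus>\<^bsub>E\<^esub> y)" using hQ(2)[OF xy(1,2)] xy by simp
    thus "i (u \<oplus>\<^bsub>Q\<^esub> v) = i u \<oplus>\<^bsub>E\<^esub> i v" using xy i by simp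
  next
    fix r u assume r: "r \<in> carrier R" and u: "u \<in> carrier Q"
    obtain x where x: "x \<in> carrier E" "u = j x" using gQ u by blast
    have "r \<odot>\<^bsub>Q\<^esub> u = j (r \<odot>\<^bsub>E\<^esub> x)" using hQ(3)[OF r x(1)] x by simp
    thus "i (r \<odot>\<^bsub>Q\<^esub> u) = r \<odot>\<^bsub>E\<^esub> i u" using x r i by simp
  qed
  moreover have "inj_on (\<lambda>u. u) (carrier Q)" by simp
  ultimately obtain r g where r: "r \<in> carrier R - {\<zero>\<^bsub>R\<^esub>}" and g: "g \<in> module_hom R P E"
      and gi: "\<And>u. u \<in> carrier Q \<Longrightarrow> g u = r \<odot>\<^bsub>E\<^esub> i u"
    using E P(1) Q(1) unfolding e_injective_def by blast
  note hg = module_homD[OF g]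
  define f3 where "f3 x = g (\<pi> (\<zero>\<^bsub>E\<^esub>, x))" for x
  have c0: "x \<in> carrier A2 \<Longrightarrow> (\<zero>\<^bsub>E\<^esub>, x) \<in> carrier S" for x using Sc by simp
  have "f3 \<in> module_hom R A2 E"
  proof (rule module_homI)
    fix x y assume xy: "x \<in> carrier A2" "y \<in> carrier A2"
    note cx = c0[OF xy(1)] and cy = c0[OF xy(2)]
    show "f3 x \<in> carrier E" unfolding f3_def by (rule hg(1)[OF hP(1)[OF cx]])
    have "(\<zero>\<^bsub>E\<^esub>, x \<oplus>\<^bsub>A2\<^esub> y) = (\<zero>\<^bsub>E\<^esub>, x) \<oplus>\<^bsub>S\<^esub> (\<zero>\<^bsub>E\<^esub>, y)" by (simp add: Sa)
    thus "f3 (x \<oplus>\<^bsub>A2\<^esub> y) = f3 x \<oplus>\<^bsub>E\<^esub> f3 y"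
      unfolding f3_def using hP(2)[OF cx cy] hg(2)[OF hP(1)[OF cx] hP(1)[OF cy]] by simp
  next
    fix r x assume t: "r \<in> carrier R" and x: "x \<in> carrier A2"
    have "(\<zero>\<^bsub>E\<^esub>, r \<odot>\<^bsub>A2\<^esub> x) = r \<odot>\<^bsub>S\<^esub> (\<zero>\<^bsub>E\<^esub>, x)" using t by (simp add: Ss)
    thus "f3 (r \<odot>\<^bsub>A2\<^esub> x) = r \<odot>\<^bsub>E\<^esub> f3 x"
      unfolding f3_def using hP(3)[OF t c0[OF x]] hg(3)[OF t hP(1)[OF c0[OF x]]] by simp
  qed
  moreover have "f3 (f1 a) = r \<odot>\<^bsub>E\<^esub> f2 a" if a: "a \<in> carrier A1" for a
  proof -
    have fa: "f1 a \<in> carrier A2" "f2 a \<in> carrier E" using h1 h2 a by auto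
    have "\<iota> (f2 a) \<ominus>\<^bsub>S\<^esub> (\<zero>\<^bsub>E\<^esub>, f1 a) = (f2 a, \<ominus>\<^bsub>A2\<^esub> f1 a)"
      using fa unfolding \<iota>_def S.minus_eq by (simp add: Sm Sa mz)
    hence "\<iota> (f2 a) \<ominus>\<^bsub>S\<^esub> (\<zero>\<^bsub>E\<^esub>, f1 a) \<in> K" using NI[OF a refl] K(2) by auto
    hence "j (f2 a) = \<pi> (\<zero>\<^bsub>E\<^esub>, f1 a)" unfolding j_def using \<pi> \<iota>c c0 fa by simp
    hence "f3 (f1 a) = g (j (f2 a))" by (simp add: f3_def)
    thus ?thesis using gi[of "j (f2 a)"] i fa Q(2) by simp
  qed
  ultimately show ?thesis using r by blast
qed

end

theory Submission
  imports Defs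
begin

text \<open>In negative degrees the deleted resolution is zero, and the torsion functor keeps it
  zero (\<open>torsion_zero_submodule\<close>). For n < 0 the cycles in degree n and the boundaries
  coming from degree n - 1 are therefore both {0}, so the cohomology is 0/0 = 0
  (\<open>quotient_zero_by_zero\<close>). The e-cohomology and the right derived functor unfold to
  the same quotient.\<close>

lemma torsion_zero_submodule:
  assumes "module R M"
  shows "torsion_module R a (zero_submodule M) = zero_submodule M"
proof -
  interpret module R M by fact
  \<comment> \<open>The exponent 0 is a witness: a^0 is all of R, and every scalar kills
    zero.\<close>
  have "\<forall>x\<in>a [^]\<^bsub>ideals_set R\<^esub> (0::nat). x \<odot>\<^bsub>M\<^esub> \<zero>\<^bsub>M\<^esub> = \<zero>\<^bsub>M\<^esub>"
    by (simp add: ideals_set_def)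
  then have "\<exists>k::nat. \<forall>x\<in>a [^]\<^bsub>ideals_set R\<^esub> k. x \<odot>\<^bsub>M\<^esub> \<zero>\<^bsub>M\<^esub> = \<zero>\<^bsub>M\<^esub>" ..
  then have "{m. m = \<zero>\<^bsub>M\<^esub> \<and> (\<exists>k::nat. \<forall>x\<in>a [^]\<^bsub>ideals_set R\<^esub> k. x \<odot>\<^bsub>M\<^esub> m = \<zero>\<^bsub>M\<^esub>)} = {\<zero>\<^bsub>M\<^esub>}"
    by blast
  then show ?thesis
    by (simp add: torsion_module_def zero_submodule_def)
qed

text \<open>The only coset is N + 0 = N, which is the zero of the quotient. \<open>M'\<close> is to
  be the module of cycles; it shares its addition with the ambient module \<open>M\<close>, which
  supplies 0 + 0 = 0.\<close>

lemma quotient_zero_by_zero: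
  assumes "module R M" and "N = {\<zero>\<^bsub>M\<^esub>}" and "carrier M' = {\<zero>\<^bsub>M\<^esub>}" and "add M' = add M"
  shows "is_zero_module (quotient_module R M' N)"
proof -
  interpret module R M by fact
  show ?thesis
    using assms
    by (simp add: is_zero_module_def quotient_module_def A_RCOSETS_def RCOSETS_def r_coset_def)
qed

theorem proposition3p4:
  fixes R :: "('r, 'q) ring_scheme"
    and a :: "'r set"
    and A :: "('r, 'm) module"
    and \<epsilon> :: "'m \<Rightarrow> 'e"
    and E :: "nat \<Rightarrow> ('r, 'e) module"
    and d :: "nat \<Rightarrow> 'e \<Rightarrow> 'e"
    and n :: int
  assumes "noetherian_domain R"
    and "ideal a R"
    and "module R A"
    and "e_injective_resolution R A \<epsilon> E d"
    and "n < 0"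
  shows "e_cohomology R a E d n =
           right_derived R (torsion_module R a) (torsion_map R a) E d n \<and>
         is_zero_module (right_derived R (torsion_module R a) (torsion_map R a) E d n)"
proof
  show "e_cohomology R a E d n =
      right_derived R (torsion_module R a) (torsion_map R a) E d n"
    by (simp add: e_cohomology_def right_derived_def cohomology_module_def Let_def)
next
  let ?G = "\<lambda>i. torsion_module R a (deleted_obj E i)"
  let ?\<gamma> = "\<lambda>i. torsion_map R a (deleted_obj E i) (deleted_obj E (i + 1)) (deleted_map E d i)"
  have E0: "module R (E 0)"
    using assms(4) by (simp add: e_injective_resolution_def e_injective_def)
  have G: "?G i = zero_submodule (E 0)" if "i < 0" for i
    using that torsion_zero_submodule[OF E0] by (simp add: deleted_obj_def)
  \<comment> \<open>\<open>torsion_map\<close> is a restriction, so its value at zero is the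
    intended one only because zero lies in the torsion part, by \<open>G\<close>.\<close>
  have \<gamma>: "?\<gamma> i \<zero>\<^bsub>E 0\<^esub> = \<zero>\<^bsub>E 0\<^esub>" if "i < 0" for i
    using that by (simp add: torsion_map_def deleted_map_def G zero_submodule_def)
  \<comment> \<open>For n = -1 the target is the torsion part of \<open>E 0\<close>, not a zero
    module; its zero element is still that of \<open>E 0\<close>.\<close>
  have zero: "\<zero>\<^bsub>?G (n + 1)\<^esub> = \<zero>\<^bsub>E 0\<^esub>"
    using \<open>n < 0\<close> by (auto simp: torsion_module_def deleted_obj_def zero_submodule_def)
  have "a_kernel (?G n) (?G (n + 1)) (?\<gamma> n) = {\<zero>\<^bsub>E 0\<^esub>}"
    using \<gamma>[OF \<open>n < 0\<close>] zero G[OF \<open>n < 0\<close>]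
    by (auto simp: a_kernel_def kernel_def zero_submodule_def)
  \<comment> \<open>Degree n - 1 is negative too, so the source is {0}.\<close>
  moreover have "?\<gamma> (n - 1) ` carrier (?G (n - 1)) = {\<zero>\<^bsub>E 0\<^esub>}"
    using \<gamma>[of "n - 1"] G[of "n - 1"] \<open>n < 0\<close> by (simp add: zero_submodule_def)
  moreover have "add (?G n) = add (E 0)"
    by (simp add: G \<open>n < 0\<close> zero_submodule_def)
  ultimately show "is_zero_module (right_derived R (torsion_module R a) (torsion_map R a) E d n)"
    unfolding right_derived_def cohomology_module_def
    by (intro quotient_zero_by_zero[OF E0]) simp_all
qed

end
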